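(* Let $f,g,c$ satisfy the standing assumption on the composite problem (P), $\min_x\Phi(x)=f(x)+g(c(x))$. Let all minimizers of (P) be nonstationary, and let the value function $\mathcal V(u)=\inf_x\{f(x)+g(c(x)-u)\}$, $u\in\mathbb R^m$, be proper and lower semicontinuous. Let $\{(x^k,z^k,y^k,\hat y^k)\}$ be a sequence generated by the augmented Lagrangian method with elastic safeguard (described in the context) such that $\sum_{k=0}^\infty\sqrt{\varepsilon_k/\mu_k}<\infty$. Then $\|y^k\|\to\infty$ and $$\limsup_{k\to\infty}\left(f(x^k)+g(z^k)\right)\le\Phi^\star .$$ Particularly, each accumulation point $\bar x\in\mathbb R^n$ of $\{x^k\}$ is a minimizer of (P). For each subsequence $\{x^k\}_{k\in K}$ ($K\subseteq\mathbb N$ infinite) converging to some $\bar x$, one has $z^k\to c(\bar x)$ and $f(x^k)+g(z^k)\to\Phi^\star$ as $k\to\infty$, $k\in K$.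
   Context: Spaces $\mathbb R^n,\mathbb R^m$ carry the Euclidean inner product $\langle\cdot,\cdot\rangle$ and norm $\|\cdot\|$; $\overline{\mathbb R}=\mathbb R\cup\{+\infty\}$. Problem (P) is: minimize $\Phi(x)=f(x)+g(c(x))$ over $x\in\mathbb R^n$. For a proper lsc convex $g:\mathbb R^m\to\overline{\mathbb R}$, the horizon is $\operatorname{hzn} g=\{v\in\mathbb R^m : g(z+v)\le g(z)\ \forall z\in\operatorname{dom} g\}$. Standing assumption: $f:\mathbb R^n\to\mathbb R$ is continuously differentiable and convex; $g:\mathbb R^m\to\overline{\mathbb R}$ is proper, lsc, convex; $c:\mathbb R^n\to\mathbb R^m$ is continuously differentiable and $(-\operatorname{hzn} g)$-convex, i.e. $c(\lambda x+(1-\lambda)x')-\lambda c(x)-(1-\lambda)c(x')\in\operatorname{hzn} g$ for all $x,x'\in\mathbb R^n$, $\lambda\in[0,1]$; (P) is feasible and possesses a minimizer, with minimal value $\Phi^\star$. A feasible point $\bar x$ is stationary if there is $\bar y\in\partial g(c(\bar x))$ with $\nabla f(\bar x)+c'(\bar x)^\top\bar y=0$; otherwise it is nonstationary. For $\mu>0$ the augmented Lagrangian is $L_\mu(x,y)=f(x)+g^\mu(c(x)+\mu y)-\frac\mu2\|y\|^2$, where $g^\mu(z)=\inf_w\{g(w)+\frac1{2\mu}\|w-z\|^2\}$ is the Moreau envelope. $\operatorname{prox}_\varphi(z)$ is the unique minimizer of $w\mapsto\varphi(w)+\frac12\|w-z\|^2$; $\operatorname{proj}_C$ is the Euclidean projection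 onto $C$. ALM with elastic safeguard. Data: $y^0\in\mathbb R^m$; $\mu_0>0$; nonempty, convex, compact set $S\subseteq\mathbb R^m$; $\theta,\eta\in(0,1)$; $\beta\in(\eta^2,\eta)$. Set $\rho_0=1$, $V^{-1}=\infty$. For $k=0,1,2,\dots$: set $\hat y^k=\operatorname{proj}_{\rho_kS}(y^k)$, where $\rho_kS=\{\rho_k s: s\in S\}$; select $\varepsilon_k\ge0$ and $x^k\in\mathbb R^n$ with $L_{\mu_k}(x^k,\hat y^k)\le\inf_x L_{\mu_k}(x,\hat y^k)+\varepsilon_k$; set $z^k=\operatorname{prox}_{\mu_kg}(c(x^k)+\mu_k\hat y^k)$ and $V^k=\|c(x^k)-z^k\|$; set $y^{k+1}=\hat y^k+\mu_k^{-1}(c(x^k)-z^k)$; if $V^k\le\theta V^{k-1}$ (always true for $k=0$), set $\mu_{k+1}=\mu_k$, $\rho_{k+1}=\rho_k$; otherwise set $\mu_{k+1}=\beta\mu_k$, $\rho_{k+1}=(\eta/\beta)\rho_k$. *)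

theory Defs
  imports "HOL-Analysis.Analysis"
begin

text \<open>
  The values \<open>\<real> \<union> {+\<infinity>}\<close> are rendered in \<^typ>\<open>ereal\<close>; properness excludes \<open>-\<infinity>\<close>.
\<close>

definition edom :: "('a \<Rightarrow> ereal) \<Rightarrow> 'a set" where
  "edom h = {z. h z < \<infinity>}"

definition proper :: "('a \<Rightarrow> ereal) \<Rightarrow> bool" where
  "proper h \<longleftrightarrow> (\<forall>z. h z \<noteq> -\<infinity>) \<and> edom h \<noteq> {}"

text \<open>The filter \<open>nhds z\<close> contains the point \<open>z\<close> itself, which does not affect the notion.\<close>

definition lsc :: "('a::topological_space \<Rightarrow> ereal) \<Rightarrow> bool" where
  "lsc h \<longleftrightarrow> (\<forall>z. h z \<le> Liminf (nhds z) h)"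

text \<open>
  Intended for functions that nowhere take the value \<open>-\<infinity>\<close>. In \<^typ>\<open>ereal\<close> one has
  \<open>0 * \<infinity> = 0\<close>, so the cases \<open>u = 0\<close> and \<open>v = 0\<close> are trivial.
\<close>

definition econvex :: "('a::real_vector \<Rightarrow> ereal) \<Rightarrow> bool" where
  "econvex h \<longleftrightarrow> (\<forall>x y. \<forall>u\<ge>0. \<forall>v\<ge>0. u + v = 1 \<longrightarrow>
     h (u *\<^sub>R x + v *\<^sub>R y) \<le> ereal u * h x + ereal v * h y)"

definition hzn :: "('a::real_vector \<Rightarrow> ereal) \<Rightarrow> 'a set" where
  "hzn g = {v. \<forall>z\<in>edom g. g (z + v) \<le> g z}"

definition subdifferential :: "('a::real_inner \<Rightarrow> ereal) \<Rightarrow> 'a \<Rightarrow> 'a set" where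
  "subdifferential g z = {v. z \<in> edom g \<and> (\<forall>w. g z + ereal (v \<bullet> (w - z)) \<le> g w)}"

definition continuously_differentiable ::
    "('a::real_normed_vector \<Rightarrow> 'b::real_normed_vector) \<Rightarrow> bool" where
  "continuously_differentiable h \<longleftrightarrow>
     (\<exists>h' :: 'a \<Rightarrow> 'a \<Rightarrow>\<^sub>L 'b. (\<forall>x. (h has_derivative blinfun_apply (h' x)) (at x)) \<and>
        continuous_on UNIV h')"

definition gradient :: "('a::real_inner \<Rightarrow> real) \<Rightarrow> 'a \<Rightarrow> 'a" where
  "gradient f x = (THE d. GDERIV f x :> d)"

definition objective :: "('a \<Rightarrow> real) \<Rightarrow> ('b \<Rightarrow> ereal) \<Rightarrow> ('a \<Rightarrow> 'b) \<Rightarrow> 'a \<Rightarrow> ereal" where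
  "objective f g c x = ereal (f x) + g (c x)"

definition feasible :: "('b \<Rightarrow> ereal) \<Rightarrow> ('a \<Rightarrow> 'b) \<Rightarrow> 'a \<Rightarrow> bool" where
  "feasible g c x \<longleftrightarrow> c x \<in> edom g"

definition minimizer :: "('a \<Rightarrow> real) \<Rightarrow> ('b \<Rightarrow> ereal) \<Rightarrow> ('a \<Rightarrow> 'b) \<Rightarrow> 'a \<Rightarrow> bool" where
  "minimizer f g c x \<longleftrightarrow>
     feasible g c x \<and> (\<forall>x'. objective f g c x \<le> objective f g c x')"

definition optimal_value :: "('a \<Rightarrow> real) \<Rightarrow> ('b \<Rightarrow> ereal) \<Rightarrow> ('a \<Rightarrow> 'b) \<Rightarrow> ereal" where
  "optimal_value f g c = (INF x. objective f g c x)"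

definition value_function ::
    "('a \<Rightarrow> real) \<Rightarrow> ('b::minus \<Rightarrow> ereal) \<Rightarrow> ('a \<Rightarrow> 'b) \<Rightarrow> 'b \<Rightarrow> ereal" where
  "value_function f g c u = (INF x. ereal (f x) + g (c x - u))"

definition stationary ::
    "(real^'n \<Rightarrow> real) \<Rightarrow> (real^'m \<Rightarrow> ereal) \<Rightarrow> (real^'n \<Rightarrow> real^'m) \<Rightarrow> real^'n \<Rightarrow> bool" where
  "stationary f g c x \<longleftrightarrow> feasible g c x \<and>
     (\<exists>y\<in>subdifferential g (c x). gradient f x + transpose (jacobian c (at x)) *v y = 0)"

definition standing_assumption ::
    "(real^'n \<Rightarrow> real) \<Rightarrow> (real^'m \<Rightarrow> ereal) \<Rightarrow> (real^'n \<Rightarrow> real^'m) \<Rightarrow> bool" where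
  "standing_assumption f g c \<longleftrightarrow>
     continuously_differentiable f \<and> convex_on UNIV f \<and>
     proper g \<and> lsc g \<and> econvex g \<and>
     continuously_differentiable c \<and>
     (\<forall>x x'. \<forall>t\<in>{0..1}.
        c (t *\<^sub>R x + (1 - t) *\<^sub>R x') - t *\<^sub>R c x - (1 - t) *\<^sub>R c x' \<in> hzn g) \<and>
     (\<exists>x. feasible g c x) \<and> (\<exists>x. minimizer f g c x)"

definition moreau_envelope ::
    "real \<Rightarrow> ('a::real_normed_vector \<Rightarrow> ereal) \<Rightarrow> 'a \<Rightarrow> ereal" where
  "moreau_envelope \<mu> g z = (INF w. g w + ereal (1 / (2 * \<mu>) * (norm (w - z))\<^sup>2))"

definition prox :: "('a::real_normed_vector \<Rightarrow> ereal) \<Rightarrow> 'a \<Rightarrow> 'a" where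
  "prox \<phi> z = (THE w. \<forall>w'.
     \<phi> w + ereal (1 / 2 * (norm (w - z))\<^sup>2) \<le> \<phi> w' + ereal (1 / 2 * (norm (w' - z))\<^sup>2))"

definition aug_lagrangian ::
    "('a \<Rightarrow> real) \<Rightarrow> ('b::real_normed_vector \<Rightarrow> ereal) \<Rightarrow> ('a \<Rightarrow> 'b) \<Rightarrow> real \<Rightarrow> 'a \<Rightarrow> 'b \<Rightarrow> ereal"
  where
  "aug_lagrangian f g c \<mu> x y =
     ereal (f x) + moreau_envelope \<mu> g (c x + \<mu> *\<^sub>R y) - ereal (\<mu> / 2 * (norm y)\<^sup>2)"

text \<open>
  The starting data \<open>y\<^sup>0\<close> and \<open>\<mu>\<^sub>0\<close> are the initial terms \<open>y 0\<close> and \<open>\<mu> 0\<close>. With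
  \<open>V k = \<parallel>c (x k) - z k\<parallel>\<close>, the convention \<open>V\<^sup>-\<^sup>1 = \<infinity>\<close> becomes the disjunct \<open>k = 0\<close>
  in the acceptance test.
\<close>

definition elastic_alm ::
    "(real^'n \<Rightarrow> real) \<Rightarrow> (real^'m \<Rightarrow> ereal) \<Rightarrow> (real^'n \<Rightarrow> real^'m) \<Rightarrow>
     (real^'m) set \<Rightarrow> real \<Rightarrow> real \<Rightarrow> real \<Rightarrow>
     (nat \<Rightarrow> real) \<Rightarrow> (nat \<Rightarrow> real) \<Rightarrow> (nat \<Rightarrow> real) \<Rightarrow>
     (nat \<Rightarrow> real^'n) \<Rightarrow> (nat \<Rightarrow> real^'m) \<Rightarrow> (nat \<Rightarrow> real^'m) \<Rightarrow> (nat \<Rightarrow> real^'m) \<Rightarrow> bool"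
  where
  "elastic_alm f g c S \<theta> \<eta> \<beta> \<epsilon> \<mu> \<rho> x z y yh \<longleftrightarrow>
     S \<noteq> {} \<and> convex S \<and> compact S \<and>
     \<theta> \<in> {0<..<1} \<and> \<eta> \<in> {0<..<1} \<and> \<beta> \<in> {\<eta>\<^sup>2<..<\<eta>} \<and>
     \<mu> 0 > 0 \<and> \<rho> 0 = 1 \<and>
     (let V = (\<lambda>k. norm (c (x k) - z k)) in
      \<forall>k.
       yh k = closest_point ((\<lambda>s. \<rho> k *\<^sub>R s) ` S) (y k) \<and>
       \<epsilon> k \<ge> 0 \<and>
       aug_lagrangian f g c (\<mu> k) (x k) (yh k)
         \<le> (INF x'. aug_lagrangian f g c (\<mu> k) x' (yh k)) + ereal (\<epsilon> k) \<and>
       z k = prox (\<lambda>w. ereal (\<mu> k) * g w) (c (x k) + \<mu> k *\<^sub>R yh k) \<and>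
       y (Suc k) = yh k + (1 / \<mu> k) *\<^sub>R (c (x k) - z k) \<and>
       (if k = 0 \<or> V k \<le> \<theta> * V (k - 1)
        then \<mu> (Suc k) = \<mu> k \<and> \<rho> (Suc k) = \<rho> k
        else \<mu> (Suc k) = \<beta> * \<mu> k \<and> \<rho> (Suc k) = (\<eta> / \<beta>) * \<rho> k))"

end

theory Submission
  imports Defs
begin

text \<open>
  Write \<open>V\<close> for the value function; it is convex because \<open>c\<close> is convex with respect to the horizon
  cone. With \<open>u k = c (x k) - z k\<close> and \<open>F k = f (x k) + g (z k) \<ge> V (u k)\<close>, the inexact minimality
  of \<open>x k\<close> says that \<open>(u k, F k)\<close> is an approximately optimal pair for minimizing
  \<open>V v + yh k \<bullet> v + \<parallel>v\<parallel>\<^sup>2 / (2 * \<mu> k)\<close>, so that \<open>- y (k + 1)\<close> is an approximate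
  subgradient of \<open>V\<close> at \<open>u k\<close>. A subgradient of \<open>V\<close> at \<open>0\<close> would make every minimizer
  stationary. Hence \<open>y (k + 1)\<close> stays bounded on no subsequence along which \<open>u\<close> tends to \<open>0\<close>.
  If the penalty parameter were updated only finitely often, then \<open>u\<close> would decay linearly and
  \<open>y\<close> would be bounded. So it is updated infinitely often, and \<open>\<beta> < 1\<close>, \<open>\<eta> < 1\<close>, \<open>\<eta>\<^sup>2 < \<beta>\<close>
  give, respectively, \<open>\<mu> k \<rightarrow> 0\<close>, \<open>\<mu> k * \<rho> k \<rightarrow> 0\<close> and \<open>\<mu> k * (\<rho> k)\<^sup>2 \<rightarrow> 0\<close>. Since \<open>V\<close>
  decreases at most linearly, \<open>u\<close> tends to \<open>0\<close>, and comparison with \<open>v = 0\<close> bounds \<open>F k\<close> from above.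
\<close>

section \<open>Lower semicontinuity and attainment of minima\<close>

lemma lsc_eventually_less:
  assumes "lsc h" and "a < h z"
  shows "eventually (\<lambda>w. a < h w) (nhds z)"
  using assms le_Liminf_iff[of "h z" "nhds z" h] unfolding lsc_def by blast

lemma lscI:
  assumes "\<And>z a. a < h z \<Longrightarrow> eventually (\<lambda>w. a < h w) (nhds z)"
  shows "lsc h"
  unfolding lsc_def using assms by (simp add: le_Liminf_iff)

lemma lsc_liminf:
  assumes "lsc h" and "X \<longlonglongrightarrow> l"
  shows "h l \<le> liminf (\<lambda>n. h (X n))"
  unfolding le_Liminf_iff
proof (intro allI impI)
  fix a assume "a < h l"
  then have "eventually (\<lambda>w. a < h w) (nhds l)"
    by (rule lsc_eventually_less[OF assms(1)])
  then show "eventually (\<lambda>n. a < h (X n)) sequentially"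
    using assms(2) by (rule eventually_compose_filterlim)
qed

lemma lsc_add_continuous:
  fixes h :: "'a::metric_space \<Rightarrow> ereal" and q :: "'a \<Rightarrow> real"
  assumes "lsc h" and "continuous_on UNIV q"
  shows "lsc (\<lambda>w. h w + ereal (q w))"
proof (rule lscI)
  fix z a
  assume a: "a < h z + ereal (q z)"
  have "a - ereal (q z) < h z"
    using a by (simp add: ereal_minus_less)
  \<comment> \<open>\<open>b\<close> is finite and splits \<open>a\<close> as
    \<open>(a - b) + b\<close>, with \<open>a - b\<close> below \<open>q\<close> and
    \<open>b\<close> below \<open>h\<close> near \<open>z\<close>.\<close>
  then obtain b where b: "a - ereal (q z) < b" "b < h z"
    using dense by blast
  have "((\<lambda>w. ereal (q w)) \<longlongrightarrow> ereal (q z)) (nhds z)"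
    using assms(2) by (simp add: continuous_on_eq_continuous_at isCont_def tendsto_at_iff_tendsto_nhds)
  moreover have "a - b < ereal (q z)"
    using b(1) by (cases a; cases b; simp)
  ultimately have "eventually (\<lambda>w. a - b < ereal (q w)) (nhds z)"
    by (rule order_tendstoD)
  moreover have "eventually (\<lambda>w. b < h w) (nhds z)"
    using assms(1) b(2) by (rule lsc_eventually_less)
  ultimately show "eventually (\<lambda>w. a < h w + ereal (q w)) (nhds z)"
  proof eventually_elim
    case (elim w)
    then show ?case by (cases a; cases b; cases "h w"; simp)
  qed
qed

lemma lsc_mult_pos:
  assumes "lsc h" and "0 < m"
  shows "lsc (\<lambda>w. ereal m * h w)"
proof (rule lscI)
  fix z a
  assume "a < ereal m * h z"
  then have "a / ereal m < h z"
    using assms(2) by (simp add: ereal_divide_less_iff mult.commute)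
  then have "eventually (\<lambda>w. a / ereal m < h w) (nhds z)"
    by (rule lsc_eventually_less[OF assms(1)])
  then show "eventually (\<lambda>w. a < ereal m * h w) (nhds z)"
    by eventually_elim (use assms(2) in \<open>simp add: ereal_divide_less_iff mult.commute\<close>)
qed

text \<open>Direct method: a cluster point of a minimizing sequence has value at most the limit of
  the values. That limit is taken in \<open>ereal\<close>, so the infimum may be infinite.\<close>

lemma lsc_attains_min:
  fixes h :: "'a::metric_space \<Rightarrow> ereal"
  assumes "lsc h" and "compact K" and "K \<noteq> {}"
  obtains p where "p \<in> K" and "\<And>w. w \<in> K \<Longrightarrow> h p \<le> h w"
proof -
  obtain v where v: "\<And>n::nat. v n \<in> h ` K" "v \<longlonglongrightarrow> Inf (h ` K)"
    using Inf_as_limit[of "h ` K"] assms(3) by auto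
  then have "\<forall>n. \<exists>w. w \<in> K \<and> v n = h w" by blast
  then obtain X where X: "\<And>n. X n \<in> K" "\<And>n. v n = h (X n)" by metis
  obtain l r where l: "l \<in> K" "strict_mono r" "(X \<circ> r) \<longlonglongrightarrow> l"
    using assms(2) X(1) unfolding compact_def by metis
  have "(v \<circ> r) \<longlonglongrightarrow> Inf (h ` K)"
    using v(2) l(2) by (rule LIMSEQ_subseq_LIMSEQ)
  then have "(\<lambda>n. h ((X \<circ> r) n)) \<longlonglongrightarrow> Inf (h ` K)"
    by (simp add: X(2) o_def)
  then have "liminf (\<lambda>n. h ((X \<circ> r) n)) = Inf (h ` K)"
    by (intro lim_imp_Liminf) auto
  with lsc_liminf[OF assms(1) l(3)] have "h l \<le> Inf (h ` K)" by simp
  then show ?thesis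
    using l(1) that by (meson INF_lower order_trans)
qed

section \<open>Growth of convex functions and the proximal map\<close>

lemma proper_edom_real:
  assumes "proper h" and "z \<in> edom h"
  obtains a where "h z = ereal a"
  using assms unfolding proper_def edom_def by (cases "h z") auto

text \<open>
  Comparing a distant point with the minimum over a unit ball yields a minorant of linear
  growth without a separation argument.
\<close>

lemma econvex_lsc_linear_growth:
  fixes h :: "'a::euclidean_space \<Rightarrow> ereal"
  assumes "proper h" and "lsc h" and "econvex h"
  obtains C where "C \<ge> 0" and "\<And>w. ereal (- C * (1 + norm w)) \<le> h w"
proof -
  obtain x0 where x0: "x0 \<in> edom h" using assms(1) unfolding proper_def by auto
  obtain a where a: "h x0 = ereal a" using proper_edom_real[OF assms(1) x0] .
  obtain p where p: "p \<in> cball x0 1" "\<And>w. w \<in> cball x0 1 \<Longrightarrow> h p \<le> h w"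
    using lsc_attains_min[OF assms(2), of "cball x0 1"] by auto
  have "h p \<le> ereal a" using p(2)[of x0] a by simp
  then obtain m where m: "h p = ereal m" "m \<le> a"
    using assms(1) unfolding proper_def by (cases "h p") auto
  \<comment> \<open>Outside the ball, the segment from \<open>x0\<close> to \<open>w\<close>
    contains a point at distance 1 from \<open>x0\<close>, where \<open>h\<close> is at least
    \<open>m\<close>; convexity then gives \<open>a - t * (a - m) \<le> h w\<close> with
    \<open>t = norm (w - x0)\<close>. Replacing \<open>t\<close> by \<open>1 + t\<close> makes one
    formula valid inside the ball too.\<close>
  have low: "ereal (a - (1 + norm (w - x0)) * (a - m)) \<le> h w" for w
  proof (cases "norm (w - x0) \<le> 1")
    case True
    then have "ereal m \<le> h w" using p(2)[of w] m by (simp add: dist_norm norm_minus_commute)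
    moreover have "a - (1 + norm (w - x0)) * (a - m) \<le> m"
      using mult_right_mono[OF m(2) norm_ge_zero[of "w - x0"]] by (simp add: algebra_simps)
    ultimately show ?thesis by (meson ereal_less_eq(3) order_trans)
  next
    case False
    define t where "t = norm (w - x0)"
    have t: "t > 1" using False t_def by simp
    let ?q = "(1 - 1/t) *\<^sub>R x0 + (1/t) *\<^sub>R w"
    have "?q - x0 = (1/t) *\<^sub>R (w - x0)" by (simp add: algebra_simps)
    then have "norm (?q - x0) = \<bar>1 / t\<bar> * t" by (simp only: norm_scaleR t_def)
    then have "norm (?q - x0) = 1" using t by simp
    then have "ereal m \<le> h ?q" using p(2)[of ?q] m by (simp add: dist_norm norm_minus_commute)
    also have "\<dots> \<le> ereal (1 - 1/t) * h x0 + ereal (1/t) * h w"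
      using assms(3) t unfolding econvex_def by simp
    finally have le: "ereal m \<le> ereal (1 - 1/t) * h x0 + ereal (1/t) * h w" .
    show ?thesis
    proof (cases "h w")
      case (real b)
      have "m \<le> (1 - 1/t) * a + (1/t) * b" using le a real by simp
      then have "t * m \<le> t * ((1 - 1/t) * a + (1/t) * b)" using t by simp
      also have "\<dots> = (t - 1) * a + b" using t by (simp add: field_simps)
      finally have "a - (1 + t) * (a - m) \<le> b"
        using m(2) by (simp add: algebra_simps)
      then show ?thesis using real t_def by simp
    qed (use assms(1) in \<open>auto simp: proper_def\<close>)
  qed
  \<comment> \<open>Comes from \<open>1 + norm (w - x0) \<le> (1 + norm x0) * (1 + norm w)\<close>,
    with \<open>\<bar>a\<bar>\<close> absorbing the constant term.\<close>
  define C where "C = \<bar>a\<bar> + (a - m) * (1 + norm x0)"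
  have "ereal (- C * (1 + norm w)) \<le> h w" for w
  proof -
    have "1 + norm (w - x0) \<le> 1 + norm w + norm x0"
      using norm_triangle_ineq4[of w x0] by simp
    also have "\<dots> \<le> (1 + norm x0) * (1 + norm w)" by (simp add: algebra_simps)
    finally have "(1 + norm (w - x0)) * (a - m) \<le> (1 + norm x0) * (1 + norm w) * (a - m)"
      using m(2) by (simp add: mult_right_mono)
    moreover have "- \<bar>a\<bar> * (1 + norm w) \<le> a"
      by (smt (verit, ccfv_SIG) mult_minus_left mult_left_le_one_le mult_le_cancel_left1 norm_ge_zero)
    ultimately have "- C * (1 + norm w) \<le> a - (1 + norm (w - x0)) * (a - m)"
      unfolding C_def by (simp add: algebra_simps)
    then show ?thesis using low[of w] by (meson ereal_less_eq(3) order_trans)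
  qed
  moreover have "C \<ge> 0" using m(2) unfolding C_def by simp
  ultimately show ?thesis using that by blast
qed

lemma econvex_mult_pos:
  assumes "econvex h" and "0 < m"
  shows "econvex (\<lambda>w. ereal m * h w)"
  unfolding econvex_def
proof (intro allI impI)
  fix x y and u v :: real
  assume uv: "0 \<le> u" "0 \<le> v" "u + v = 1"
  have "ereal m * h (u *\<^sub>R x + v *\<^sub>R y) \<le> ereal m * (ereal u * h x + ereal v * h y)"
    using assms uv unfolding econvex_def by (intro ereal_mult_left_mono) auto
  also have "\<dots> = ereal m * (ereal u * h x) + ereal m * (ereal v * h y)"
    using assms(2) by (cases "ereal u * h x"; cases "ereal v * h y") (auto simp: distrib_left)
  also have "\<dots> = ereal u * (ereal m * h x) + ereal v * (ereal m * h y)"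
    by (simp only: mult.left_commute)
  finally show "ereal m * h (u *\<^sub>R x + v *\<^sub>R y) \<le> ereal u * (ereal m * h x) + ereal v * (ereal m * h y)" .
qed

lemma proper_mult_pos:
  assumes "proper h" and "0 < m"
  shows "proper (\<lambda>w. ereal m * h w)"
proof -
  obtain z where "z \<in> edom h" using assms(1) unfolding proper_def by auto
  then have "z \<in> edom (\<lambda>w. ereal m * h w)"
    using assms(2) unfolding edom_def by (cases "h z") auto
  moreover have "ereal m * h w \<noteq> -\<infinity>" for w
    using assms unfolding proper_def by (cases "h w") auto
  ultimately show ?thesis unfolding proper_def by auto
qed

text \<open>As \<open>prox\<close> is a definite description, existence and uniqueness of the
  minimizer both have to be shown. The quadratic beats the linear minorant of \<open>\<phi>\<close>,
  which confines the minimization to a ball; the parallelogram identity rules out two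
  minimizers.\<close>

lemma prox_minimizes:
  fixes \<phi> :: "'a::euclidean_space \<Rightarrow> ereal"
  assumes "proper \<phi>" and "lsc \<phi>" and "econvex \<phi>"
  shows "\<phi> (prox \<phi> z) + ereal (1 / 2 * (norm (prox \<phi> z - z))\<^sup>2)
           \<le> \<phi> w + ereal (1 / 2 * (norm (w - z))\<^sup>2)"
proof -
  define Q where "Q w = \<phi> w + ereal (1 / 2 * (norm (w - z))\<^sup>2)" for w
  obtain C where C: "C \<ge> 0" "\<And>w. ereal (- C * (1 + norm w)) \<le> \<phi> w"
    using econvex_lsc_linear_growth[OF assms] by auto
  obtain x0 where x0: "x0 \<in> edom \<phi>" using assms(1) unfolding proper_def by auto
  obtain a where a: "\<phi> x0 = ereal a" using proper_edom_real[OF assms(1) x0] .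
  define q where "q = a + 1 / 2 * (norm (x0 - z))\<^sup>2"
  have Qx0: "Q x0 = ereal q" by (simp add: Q_def q_def a)
  \<comment> \<open>For \<open>t > R\<close>, the summand \<open>2 * C + 2\<close> gives
    \<open>t / 2 - C > 1\<close>, and the absolute value then lifts the minorant to at least
    \<open>q\<close>, the value at \<open>x0\<close>; the last summand keeps \<open>x0\<close> in
    the ball.\<close>
  define R where "R = 2 * C + 2 + \<bar>q + C * (1 + norm z)\<bar> + norm (x0 - z)"
  have "lsc Q" unfolding Q_def
    by (intro lsc_add_continuous assms(2) continuous_intros)
  moreover have "R \<ge> 0" using C(1) by (simp add: R_def)
  then have "cball z R \<noteq> {}" by simp
  ultimately obtain p where p: "\<And>w. w \<in> cball z R \<Longrightarrow> Q p \<le> Q w"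
    using lsc_attains_min[of Q "cball z R"] by auto
  have "x0 \<in> cball z R" using C(1) by (simp add: R_def dist_norm norm_minus_commute)
  then have px0: "Q p \<le> ereal q" using p Qx0 by metis
  have min: "Q p \<le> Q w" for w
  proof (cases "w \<in> cball z R")
    case False
    define t where "t = norm (w - z)"
    have t: "t > R" using False by (simp add: t_def dist_norm norm_minus_commute)
    have "t * 1 \<le> t * (t / 2 - C)"
      using t C(1) norm_ge_zero[of "x0 - z"] unfolding R_def by (intro mult_left_mono) linarith+
    then have "q + C * (1 + norm z) \<le> t * (t / 2 - C)"
      using t C(1) norm_ge_zero[of "x0 - z"] unfolding R_def by linarith
    moreover have "C * norm w \<le> C * (t + norm z)"
      using C(1) norm_triangle_sub[of w z] unfolding t_def by (intro mult_left_mono) (auto simp: add.commute)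
    ultimately have "q \<le> - C * (1 + norm w) + 1 / 2 * t\<^sup>2"
      by (simp add: algebra_simps power2_eq_square)
    then have "ereal q \<le> ereal (- C * (1 + norm w)) + ereal (1 / 2 * t\<^sup>2)" by simp
    also have "\<dots> \<le> Q w" unfolding Q_def t_def using C(2) by (intro add_right_mono)
    finally show ?thesis using px0 by simp
  qed (rule p)
  have uniq: "w = p" if w: "\<forall>w'. Q w \<le> Q w'" for w
  proof (rule ccontr)
    assume ne: "w \<noteq> p"
    have "Q w = Q p" using w min by (simp add: antisym)
    obtain b where b: "\<phi> p = ereal b"
      using px0 assms(1) unfolding Q_def proper_def by (cases "\<phi> p") auto
    obtain b' where b': "\<phi> w = ereal b'"
      using px0 \<open>Q w = Q p\<close> assms(1) unfolding Q_def proper_def by (cases "\<phi> w") auto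
    have eq: "b' + 1 / 2 * (norm (w - z))\<^sup>2 = b + 1 / 2 * (norm (p - z))\<^sup>2"
      using \<open>Q w = Q p\<close> by (simp add: Q_def b b')
    \<comment> \<open>At the midpoint \<open>Q\<close> would lie below the common minimum by at
      least \<open>(norm (w - p))\<^sup>2 / 8\<close>.\<close>
    let ?m = "(1/2) *\<^sub>R w + (1/2) *\<^sub>R p"
    have "\<forall>x y. \<forall>u\<ge>0. \<forall>v\<ge>0. u + v = 1 \<longrightarrow>
       \<phi> (u *\<^sub>R x + v *\<^sub>R y) \<le> ereal u * \<phi> x + ereal v * \<phi> y"
      using assms(3) unfolding econvex_def .
    from this[rule_format, of "1/2" "1/2" w p]
    have "\<phi> ?m \<le> ereal (1/2 * b' + 1/2 * b)" by (simp add: b b')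
    then have "Q ?m \<le> ereal (1/2 * b' + 1/2 * b) + ereal (1 / 2 * (norm (?m - z))\<^sup>2)"
      unfolding Q_def by (rule add_right_mono)
    moreover have "Q p \<le> Q ?m" by (rule min)
    ultimately have "ereal b + ereal (1 / 2 * (norm (p - z))\<^sup>2)
        \<le> ereal (1/2 * b' + 1/2 * b) + ereal (1 / 2 * (norm (?m - z))\<^sup>2)"
      unfolding Q_def b by (rule order_trans[rotated])
    then have 1: "b + 1 / 2 * (norm (p - z))\<^sup>2 \<le> 1/2 * b' + 1/2 * b + 1 / 2 * (norm (?m - z))\<^sup>2"
      by simp
    have "?m - z = (1/2) *\<^sub>R ((w - z) + (p - z))"
      by (simp add: algebra_simps flip: scaleR_left_distrib)
    then have "(norm (?m - z))\<^sup>2 = 1/4 * (norm ((w - z) + (p - z)))\<^sup>2"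
      by (simp add: power_divide)
    moreover have "(norm ((w - z) + (p - z)))\<^sup>2 + (norm (w - p))\<^sup>2
        = 2 * (norm (w - z))\<^sup>2 + 2 * (norm (p - z))\<^sup>2"
      unfolding power2_norm_eq_inner by (simp add: algebra_simps inner_commute)
    ultimately have "(norm (w - p))\<^sup>2 \<le> 0" using 1 eq by argo
    then show False using ne by simp
  qed
  have "prox \<phi> z = p"
    unfolding prox_def Q_def[symmetric] by (rule the_equality) (use min uniq in auto)
  then show ?thesis using min unfolding Q_def by simp
qed

text \<open>The objective defining \<open>prox\<close> of \<open>m * g\<close> is \<open>m\<close>
  times the one in the Moreau envelope, so the prox point attains the envelope.\<close>

lemma prox_mult_minimizes:
  fixes g :: "'a::euclidean_space \<Rightarrow> ereal"
  and z :: "'a"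
  assumes "proper g" and "lsc g" and "econvex g" and m: "0 < m"
  defines "p \<equiv> prox (\<lambda>w. ereal m * g w) z"
  shows "g p + ereal (1 / (2 * m) * (norm (p - z))\<^sup>2) \<le> moreau_envelope m g z"
    and "p \<in> edom g"
proof -
  have le: "ereal m * g p + ereal (1 / 2 * (norm (p - z))\<^sup>2)
      \<le> ereal m * g w + ereal (1 / 2 * (norm (w - z))\<^sup>2)" for w
    unfolding p_def using assms
    by (intro prox_minimizes proper_mult_pos lsc_mult_pos econvex_mult_pos)
  obtain x0 where x0: "x0 \<in> edom g" using assms(1) unfolding proper_def by auto
  obtain a where a: "g x0 = ereal a" using proper_edom_real[OF assms(1) x0] .
  have "g p \<noteq> \<infinity>" using le[of x0] m a by auto
  then obtain b where b: "g p = ereal b" using assms(1) unfolding proper_def by (cases "g p") auto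
  then show "p \<in> edom g" by (simp add: edom_def)
  show "g p + ereal (1 / (2 * m) * (norm (p - z))\<^sup>2) \<le> moreau_envelope m g z"
    unfolding moreau_envelope_def
  proof (rule INF_greatest)
    fix w
    show "g p + ereal (1 / (2 * m) * (norm (p - z))\<^sup>2) \<le> g w + ereal (1 / (2 * m) * (norm (w - z))\<^sup>2)"
    proof (cases "g w")
      case (real d)
      have "m * b + 1 / 2 * (norm (p - z))\<^sup>2 \<le> m * d + 1 / 2 * (norm (w - z))\<^sup>2"
        using le[of w] by (simp add: b real)
      then have "(m * b + 1 / 2 * (norm (p - z))\<^sup>2) / m \<le> (m * d + 1 / 2 * (norm (w - z))\<^sup>2) / m"
        using m by (intro divide_right_mono) auto
      then show ?thesis using m by (simp add: b real add_divide_distrib)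
    qed (use assms(1) in \<open>auto simp: proper_def\<close>)
  qed
qed

section \<open>Limits of approximate subgradients\<close>

text \<open>
  The optimality condition is tested at \<open>u k + t (v - u k)\<close> with \<open>t = s * \<mu> k\<close>: after division by
  \<open>t\<close> the quadratic term contributes \<open>O(s)\<close> and the inexactness \<open>(\<epsilon> k / \<mu> k) / s\<close>, so one
  first lets \<open>k \<rightarrow> \<infinity>\<close> and then \<open>s \<rightarrow> 0\<close>.
\<close>

lemma subdifferential_limit:
  fixes V :: "'a::euclidean_space \<Rightarrow> ereal"
  assumes V: "proper V" "lsc V" "econvex V" and V0: "0 \<in> edom V"
    and bound: "\<And>k v. ereal (F k + yh k \<bullet> u k + (norm (u k))\<^sup>2 / (2 * \<mu> k)
                  - yh k \<bullet> v - (norm v)\<^sup>2 / (2 * \<mu> k) - \<epsilon> k) \<le> V v"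
    and VF: "\<And>k. V (u k) \<le> ereal (F k)"
    and \<mu>: "\<And>k. 0 < \<mu> k" "\<And>k. \<mu> k \<le> M"
    and u: "u \<longlonglongrightarrow> 0"
    and \<epsilon>: "(\<lambda>k. \<epsilon> k / \<mu> k) \<longlonglongrightarrow> 0"
    and q: "(\<lambda>k. yh k + (1 / \<mu> k) *\<^sub>R u k) \<longlonglongrightarrow> q"
  shows "- q \<in> subdifferential V 0"
proof -
  obtain v0 where v0: "V 0 = ereal v0" using proper_edom_real[OF V(1) V0] .
  have M: "M > 0" using \<mu>[of 0] by simp
  have "V 0 + ereal (- q \<bullet> (v - 0)) \<le> V v" for v
  proof (cases "V v")
    case (real b)
    \<comment> \<open>\<open>M\<close> bounds every \<open>\<mu> k\<close>, so
      \<open>s < 1 / M\<close> keeps \<open>s * \<mu> k\<close> in (0, 1] for all \<open>k\<close>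
      at once and the test point is a convex combination.\<close>
    have step: "v0 \<le> b + q \<bullet> v + s * ((norm v)\<^sup>2 / 2)" if s: "0 < s" "s < 1 / M" for s
    proof -
      let ?R = "\<lambda>k. b + (yh k + (1 / \<mu> k) *\<^sub>R u k) \<bullet> (v - u k)
                 + s * ((norm (v - u k))\<^sup>2 / 2) + (\<epsilon> k / \<mu> k) / s"
      have le: "V (u k) \<le> ereal (?R k)" for k
      proof -
        define t where "t = s * \<mu> k"
        have "s * \<mu> k \<le> s * M" using \<mu>[of k] s by simp
        also have "\<dots> \<le> 1" using s M by (simp add: field_simps)
        finally have t: "0 < t" "t \<le> 1" using s \<mu>(1)[of k] by (auto simp: t_def)
        define d where "d = v - u k"
        let ?w = "(1 - t) *\<^sub>R u k + t *\<^sub>R v"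
        have w: "?w = u k + t *\<^sub>R d" by (simp add: d_def algebra_simps)
        have "V ?w \<le> ereal (1 - t) * V (u k) + ereal t * V v"
          using V(3) t unfolding econvex_def by simp
        also have "\<dots> \<le> ereal (1 - t) * ereal (F k) + ereal t * ereal b"
          unfolding real using t VF by (intro add_right_mono ereal_mult_left_mono) auto
        finally have "V ?w \<le> ereal ((1 - t) * F k + t * b)" by simp
        with bound[of k ?w] have "F k + yh k \<bullet> u k + (norm (u k))\<^sup>2 / (2 * \<mu> k)
            - yh k \<bullet> ?w - (norm ?w)\<^sup>2 / (2 * \<mu> k) - \<epsilon> k \<le> (1 - t) * F k + t * b"
          by (meson ereal_less_eq(3) order_trans)
        moreover have "(norm ?w)\<^sup>2 = (norm (u k))\<^sup>2 + 2 * t * (u k \<bullet> d) + t\<^sup>2 * (norm d)\<^sup>2"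
          unfolding w power2_norm_eq_inner by (simp add: algebra_simps inner_commute power2_eq_square)
        moreover have "yh k \<bullet> ?w = yh k \<bullet> u k + t * (yh k \<bullet> d)"
          unfolding w by (simp add: inner_add_right)
        ultimately have "t * F k \<le> t * b + t * (yh k \<bullet> d)
            + (2 * t * (u k \<bullet> d) + t\<^sup>2 * (norm d)\<^sup>2) / (2 * \<mu> k) + \<epsilon> k"
          by (simp add: algebra_simps add_divide_distrib)
        then have "(t * F k) / t \<le> (t * b + t * (yh k \<bullet> d)
            + (2 * t * (u k \<bullet> d) + t\<^sup>2 * (norm d)\<^sup>2) / (2 * \<mu> k) + \<epsilon> k) / t"
          using t by (intro divide_right_mono) auto
        also have "\<dots> = b + (yh k + (1 / \<mu> k) *\<^sub>R u k) \<bullet> d + s * ((norm d)\<^sup>2 / 2) + (\<epsilon> k / \<mu> k) / s"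
          using s \<mu>(1)[of k] unfolding t_def
          by (simp add: field_simps inner_add_left power2_eq_square)
        finally have "F k \<le> ?R k" using t by (simp add: d_def)
        then show ?thesis using VF[of k] by (meson ereal_less_eq(3) order_trans)
      qed
      \<comment> \<open>Here \<open>s\<close> stays fixed. Lower semicontinuity is applied to
        \<open>V (u k)\<close>, since nothing is known about convergence of
        \<open>F k\<close>.\<close>
      have "?R \<longlonglongrightarrow> b + q \<bullet> (v - 0) + s * ((norm (v - 0))\<^sup>2 / 2) + 0 / s"
        by (intro tendsto_intros u \<epsilon> q) (use s in auto)
      then have "liminf (\<lambda>k. ereal (?R k)) = ereal (b + q \<bullet> v + s * ((norm v)\<^sup>2 / 2))"
        by (intro lim_imp_Liminf) auto
      moreover have "V 0 \<le> liminf (\<lambda>k. V (u k))" by (rule lsc_liminf[OF V(2) u])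
      moreover have "liminf (\<lambda>k. V (u k)) \<le> liminf (\<lambda>k. ereal (?R k))"
        using le by (intro Liminf_mono) auto
      ultimately have "ereal v0 \<le> ereal (b + q \<bullet> v + s * ((norm v)\<^sup>2 / 2))"
        unfolding v0 by (metis order_trans)
      then show ?thesis by simp
    qed
    have "((\<lambda>s. b + q \<bullet> v + s * ((norm v)\<^sup>2 / 2)) \<longlongrightarrow> b + q \<bullet> v + 0 * ((norm v)\<^sup>2 / 2)) (at_right 0)"
      by (intro tendsto_intros)
    moreover have "eventually (\<lambda>s. v0 \<le> b + q \<bullet> v + s * ((norm v)\<^sup>2 / 2)) (at_right 0)"
      unfolding eventually_at_right_field using step M by (intro exI[of _ "1 / M"]) auto
    ultimately have "v0 \<le> b + q \<bullet> v"
      using tendsto_lowerbound by fastforce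
    then show ?thesis by (simp add: v0 real)
  qed (use V(1) in \<open>auto simp: proper_def\<close>)
  then show ?thesis using V0 by (simp add: subdifferential_def)
qed

section \<open>Convexity of the value function\<close>

text \<open>Serves functions defined as infima that may not be attained: strict upper bounds are
  realized by actual points, and the excess \<open>e\<close> is finally sent to 0.\<close>

lemma econvexI_strict:
  fixes h :: "'a::real_vector \<Rightarrow> ereal"
  assumes "\<And>z. h z \<noteq> -\<infinity>"
    and conv: "\<And>x y a b u v. \<lbrakk>h x < ereal a; h y < ereal b; 0 < u; 0 < v; u + v = 1\<rbrakk>
           \<Longrightarrow> h (u *\<^sub>R x + v *\<^sub>R y) \<le> ereal (u * a + v * b)"
  shows "econvex h"
  unfolding econvex_def
proof (intro allI impI)
  fix x y :: 'a and u v :: real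
  assume uv: "0 \<le> u" "0 \<le> v" "u + v = 1"
  consider "u = 0" | "v = 0" | "0 < u" "0 < v" using uv by linarith
  then show "h (u *\<^sub>R x + v *\<^sub>R y) \<le> ereal u * h x + ereal v * h y"
  proof cases
    case 3
    show ?thesis
    proof (cases "h x = \<infinity> \<or> h y = \<infinity>")
      case True
      then have "ereal u * h x + ereal v * h y = \<infinity>"
        using 3 assms(1)[of x] assms(1)[of y] by (cases "h x"; cases "h y") auto
      then show ?thesis by (metis ereal_less_eq(1))
    next
      case False
      then obtain a b where ab: "h x = ereal a" "h y = ereal b"
        using assms(1) by (metis ereal_cases)
      show ?thesis
      proof (rule ereal_le_epsilon2)
        fix e :: real assume "0 < e"
        then have "h (u *\<^sub>R x + v *\<^sub>R y) \<le> ereal (u * (a + e) + v * (b + e))"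
          using 3 uv by (intro conv) (auto simp: ab)
        also have "u * (a + e) + v * (b + e) = u * a + v * b + (u + v) * e"
          by (simp add: algebra_simps)
        finally show "h (u *\<^sub>R x + v *\<^sub>R y) \<le> ereal u * h x + ereal v * h y + ereal e"
          using uv by (simp add: ab)
      qed
    qed
  qed (use uv in \<open>auto simp flip: zero_ereal_def one_ereal_def\<close>)
qed

text \<open>Points \<open>x\<close>, \<open>x'\<close> realizing strict bounds at \<open>p\<close>,
  \<open>p'\<close> are averaged. The convexity defect \<open>d\<close> of \<open>c\<close> is a
  horizon direction, so shifting the averaged argument \<open>w\<close> by \<open>d\<close> does not
  increase \<open>g\<close>, and \<open>w + d\<close> is the argument belonging to the averaged
  point.\<close>

lemma value_function_econvex:
  assumes f: "convex_on UNIV f"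
    and g: "proper g" "econvex g"
    and c: "\<And>x x' t. t \<in> {0..1} \<Longrightarrow>
        c (t *\<^sub>R x + (1 - t) *\<^sub>R x') - t *\<^sub>R c x - (1 - t) *\<^sub>R c x' \<in> hzn g"
    and V: "proper (value_function f g c)"
  shows "econvex (value_function f g c)"
proof (rule econvexI_strict)
  show "value_function f g c z \<noteq> -\<infinity>" for z using V unfolding proper_def by blast
next
  fix p p' and a a' u v :: real
  assume "value_function f g c p < ereal a" "value_function f g c p' < ereal a'"
    and uv: "0 < u" "0 < v" "u + v = 1"
  then obtain x x' where x: "ereal (f x) + g (c x - p) < ereal a"
      "ereal (f x') + g (c x' - p') < ereal a'"
    unfolding value_function_def INF_less_iff by blast
  obtain b where b: "g (c x - p) = ereal b"
    using x(1) g(1) unfolding proper_def by (cases "g (c x - p)") auto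
  obtain b' where b': "g (c x' - p') = ereal b'"
    using x(2) g(1) unfolding proper_def by (cases "g (c x' - p')") auto
  define X where "X = u *\<^sub>R x + v *\<^sub>R x'"
  define w where "w = u *\<^sub>R (c x - p) + v *\<^sub>R (c x' - p')"
  define d where "d = c X - u *\<^sub>R c x - v *\<^sub>R c x'"
  have "u \<in> {0..1}" and v: "1 - u = v" using uv by auto
  then have "d \<in> hzn g" using c[of u x x'] unfolding d_def X_def v by blast
  have gw: "g w \<le> ereal (u * b + v * b')"
    using g(2) uv unfolding econvex_def w_def by (metis b b' less_imp_le plus_ereal.simps(1) times_ereal.simps(1))
  \<comment> \<open>\<open>hzn\<close> constrains \<open>g\<close> only from points of
    \<open>edom g\<close>.\<close>
  then have "w \<in> edom g" unfolding edom_def by auto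
  then have "g (w + d) \<le> g w" using \<open>d \<in> hzn g\<close> unfolding hzn_def by simp
  moreover have "w + d = c X - (u *\<^sub>R p + v *\<^sub>R p')"
    by (simp add: w_def d_def algebra_simps)
  moreover have "f X \<le> u * f x + v * f x'"
    using f uv unfolding convex_on_def X_def by simp
  ultimately have "ereal (f X) + g (c X - (u *\<^sub>R p + v *\<^sub>R p'))
      \<le> ereal (u * f x + v * f x') + ereal (u * b + v * b')"
    using gw by (intro add_mono) auto
  also have "\<dots> \<le> ereal (u * a + v * a')"
  proof -
    have "u * (f x + b) \<le> u * a" "v * (f x' + b') \<le> v * a'"
      using x uv by (auto simp: b b')
    then show ?thesis by (simp add: algebra_simps)
  qed
  finally show "value_function f g c (u *\<^sub>R p + v *\<^sub>R p') \<le> ereal (u * a + v * a')"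
    unfolding value_function_def by (rule INF_lower2[OF UNIV_I])
qed

section \<open>Subgradients of the value function and stationarity\<close>

lemma continuously_differentiable_imp_has_derivative:
  assumes "continuously_differentiable h"
  obtains D where "(h has_derivative D) (at x)"
  using assms unfolding continuously_differentiable_def by blast

text \<open>The Riesz representative of \<open>D\<close> is its adjoint at 1; uniqueness of the
  derivative identifies it with the definite description \<open>gradient\<close>.\<close>

lemma gradient_works:
  fixes f :: "'a::euclidean_space \<Rightarrow> real"
  assumes "(f has_derivative D) (at x)"
  shows "D = (\<lambda>h. gradient f x \<bullet> h)"
proof -
  have "linear D" using assms has_derivative_linear by blast
  then have D: "D = (\<lambda>h. h \<bullet> adjoint D 1)"
    using adjoint_works[of D] by (simp add: fun_eq_iff)
  then have G: "GDERIV f x :> adjoint D 1"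
    unfolding gderiv_def using assms by simp
  have "gradient f x = adjoint D 1"
    unfolding gradient_def
  proof (rule the_equality)
    show "GDERIV f x :> adjoint D 1" by (rule G)
  next
    fix d assume "GDERIV f x :> d"
    then have "(\<lambda>h. h \<bullet> d) = D"
      unfolding gderiv_def using assms has_derivative_unique by blast
    then show "d = adjoint D 1" using D by (metis inner_commute vector_eq_ldot)
  qed
  then show ?thesis using D by (simp add: inner_commute)
qed

text \<open>The subgradient inequality at 0 holds jointly in \<open>x\<close> and \<open>p\<close>.
  Fixing \<open>x = xb\<close> puts \<open>y\<close> in the subdifferential of \<open>g\<close> at
  \<open>c xb\<close>; taking \<open>p = c x - c xb\<close> freezes the argument of
  \<open>g\<close>, so \<open>xb\<close> minimizes \<open>f x + y \<bullet> c x\<close> and the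
  derivative vanishes there.\<close>

lemma value_subgradient_imp_stationary:
  fixes f :: "real^'n \<Rightarrow> real" and g :: "real^'m \<Rightarrow> ereal" and c :: "real^'n \<Rightarrow> real^'m"
  assumes f: "continuously_differentiable f" and c: "continuously_differentiable c"
    and g: "proper g"
    and xb: "minimizer f g c xb"
    and y: "- y \<in> subdifferential (value_function f g c) 0"
  shows "stationary f g c xb"
proof -
  have dom: "c xb \<in> edom g" using xb by (simp add: minimizer_def feasible_def)
  obtain b where b: "g (c xb) = ereal b" using proper_edom_real[OF g dom] .
  have "value_function f g c 0 = objective f g c xb"
    unfolding value_function_def using xb
    by (intro antisym INF_lower2[of xb] INF_greatest) (auto simp: minimizer_def objective_def)
  then have "ereal (f xb + b) - ereal (y \<bullet> p) \<le> value_function f g c p" for p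
    using y by (simp add: subdifferential_def objective_def b)
  then have le: "ereal (f xb + b) - ereal (y \<bullet> p) \<le> ereal (f x) + g (c x - p)" for x p
    unfolding value_function_def by (meson INF_lower UNIV_I order_trans)
  have "g (c xb) + ereal (y \<bullet> (w - c xb)) \<le> g w" for w
    using le[of "c xb - w" xb] b by (cases "g w") (auto simp: inner_diff_right)
  then have "y \<in> subdifferential g (c xb)" using dom by (simp add: subdifferential_def)
  moreover have "gradient f xb + transpose (jacobian c (at xb)) *v y = 0"
  proof -
    obtain Df where Df: "(f has_derivative Df) (at xb)"
      using continuously_differentiable_imp_has_derivative[OF f] .
    obtain Dc where Dc: "(c has_derivative Dc) (at xb)"
      using continuously_differentiable_imp_has_derivative[OF c] .
    have "f xb + y \<bullet> c xb \<le> f x + y \<bullet> c x" for x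
      using le[of "c x - c xb" x] by (simp add: b inner_diff_right)
    moreover have "((\<lambda>x. f x + y \<bullet> c x) has_derivative (\<lambda>h. Df h + y \<bullet> Dc h)) (at xb)"
      by (intro derivative_intros Df Dc)
    ultimately have "(\<lambda>h. Df h + y \<bullet> Dc h) = (\<lambda>h. 0)"
      by (intro has_derivative_local_min[of "\<lambda>x. f x + y \<bullet> c x"]) auto
    moreover have "y \<bullet> Dc h = (transpose (jacobian c (at xb)) *v y) \<bullet> h" for h
    proof -
      have "Dc h = jacobian c (at xb) *v h"
        using Dc jacobian_works[of c "at xb"]
        by (metis differentiableI has_derivative_unique)
      then show ?thesis by (simp add: dot_lmul_matrix)
    qed
    ultimately have "(gradient f xb + transpose (jacobian c (at xb)) *v y) \<bullet> h = 0" for h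
      using gradient_works[OF Df] by (simp add: inner_add_left fun_eq_iff)
    then show ?thesis by (metis inner_eq_zero_iff)
  qed
  ultimately show ?thesis using dom unfolding stationary_def feasible_def by blast
qed

section \<open>The augmented Lagrangian as a proximal problem\<close>

text \<open>
  Partial minimization over \<open>c x - w\<close> turns the augmented Lagrangian into a proximal term
  for the value function.
\<close>

lemma aug_lagrangian_value_bound:
  fixes f :: "'a \<Rightarrow> real" and g :: "'b::euclidean_space \<Rightarrow> ereal"
  assumes g: "proper g" "lsc g" "econvex g" and m: "0 < m"
    and z: "z = prox (\<lambda>w. ereal m * g w) (c x + m *\<^sub>R y)"
    and G: "g z = ereal G"
    and opt: "aug_lagrangian f g c m x y \<le> (INF x'. aug_lagrangian f g c m x' y) + ereal e"
  shows "ereal (f x + G + y \<bullet> (c x - z) + (norm (c x - z))\<^sup>2 / (2 * m)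
           - y \<bullet> v - (norm v)\<^sup>2 / (2 * m) - e) \<le> value_function f g c v"
  unfolding value_function_def
proof (rule INF_greatest)
  fix x'
  \<comment> \<open>Completed square for \<open>d = c x - w\<close>: the shift by
    \<open>m *\<^sub>R y\<close> and the subtracted \<open>m / 2 * (norm y)\<^sup>2\<close> leave
    one linear and one quadratic term in \<open>d\<close>.\<close>
  have sq: "1 / (2 * m) * (norm (- d - m *\<^sub>R y))\<^sup>2 - m / 2 * (norm y)\<^sup>2
      = y \<bullet> d + (norm d)\<^sup>2 / (2 * m)" for d
    using m unfolding power2_norm_eq_inner
    by (simp add: field_simps inner_simps inner_commute power2_eq_square)
  show "ereal (f x + G + y \<bullet> (c x - z) + (norm (c x - z))\<^sup>2 / (2 * m)
           - y \<bullet> v - (norm v)\<^sup>2 / (2 * m) - e) \<le> ereal (f x') + g (c x' - v)"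
  proof (cases "g (c x' - v)")
    case (real b)
    let ?q = "\<lambda>d. 1 / (2 * m) * (norm (- d - m *\<^sub>R y))\<^sup>2"
    have e1: "z - (c x + m *\<^sub>R y) = - (c x - z) - m *\<^sub>R y" by simp
    have e2: "(c x' - v) - (c x' + m *\<^sub>R y) = - v - m *\<^sub>R y" by simp
    have "ereal G + ereal (?q (c x - z)) \<le> moreau_envelope m g (c x + m *\<^sub>R y)"
      using prox_mult_minimizes(1)[OF g m, of "c x + m *\<^sub>R y"] unfolding z[symmetric] G e1 .
    then have "ereal (f x) + (ereal G + ereal (?q (c x - z))) - ereal (m / 2 * (norm y)\<^sup>2)
        \<le> aug_lagrangian f g c m x y"
      unfolding aug_lagrangian_def by (intro ereal_minus_mono add_left_mono) auto
    also have "\<dots> \<le> (INF x'. aug_lagrangian f g c m x' y) + ereal e" by (rule opt)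
    also have "\<dots> \<le> aug_lagrangian f g c m x' y + ereal e"
      by (intro add_right_mono INF_lower) auto
    \<comment> \<open>The test point \<open>c x' - v\<close> in the envelope has residual exactly
      \<open>v\<close>.\<close>
    also have "moreau_envelope m g (c x' + m *\<^sub>R y) \<le> ereal b + ereal (?q v)"
      unfolding moreau_envelope_def by (rule INF_lower2[of "c x' - v"]) (auto simp: real e2)
    then have "aug_lagrangian f g c m x' y + ereal e
        \<le> ereal (f x') + (ereal b + ereal (?q v)) - ereal (m / 2 * (norm y)\<^sup>2) + ereal e"
      unfolding aug_lagrangian_def by (intro add_right_mono ereal_minus_mono add_left_mono) auto
    finally have "f x + G + (?q (c x - z) - m / 2 * (norm y)\<^sup>2)
        \<le> f x' + b + (?q v - m / 2 * (norm y)\<^sup>2) + e"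
      by simp
    then show ?thesis unfolding sq by (simp add: real)
  qed (use g(1) in \<open>auto simp: proper_def\<close>)
qed

section \<open>Vanishing residuals, subsequences and counting of updates\<close>

text \<open>Otherwise \<open>s\<close> and \<open>s - a\<close> both exceed \<open>sqrt b\<close>,
  so \<open>s * (s - a) > b\<close>. The form suits limits: the bound tends to 0 with
  \<open>a\<close> and \<open>b\<close>.\<close>

lemma le_quadratic_bound:
  fixes a b s :: real
  assumes "s\<^sup>2 \<le> a * s + b" and "0 \<le> a" and "0 \<le> b"
  shows "s \<le> a + sqrt b"
proof (rule ccontr)
  assume "\<not> s \<le> a + sqrt b"
  then have "sqrt b < s - a" and "sqrt b < s" using assms(2) by auto
  then have "sqrt b * sqrt b < s * (s - a)"
    using assms(3) by (intro mult_strict_mono') auto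
  then show False using assms by (simp add: algebra_simps power2_eq_square)
qed

text \<open>Comparison with \<open>v = 0\<close> and the linear minorant of \<open>V\<close> bound
  \<open>(norm (u k))\<^sup>2 / (2 * \<mu> k)\<close> by an affine expression in
  \<open>norm (u k)\<close>. After multiplication by \<open>2 * \<mu> k\<close> its coefficients
  \<open>a k\<close> and \<open>b k\<close> tend to 0.\<close>

lemma proximal_residual_tendsto_0:
  fixes V :: "'a::euclidean_space \<Rightarrow> ereal"
  assumes V: "proper V" "lsc V" "econvex V" and V0: "0 \<in> edom V"
    and bound: "\<And>k v. ereal (F k + yh k \<bullet> u k + (norm (u k))\<^sup>2 / (2 * \<mu> k)
                  - yh k \<bullet> v - (norm v)\<^sup>2 / (2 * \<mu> k) - \<epsilon> k) \<le> V v"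
    and VF: "\<And>k. V (u k) \<le> ereal (F k)"
    and \<mu>: "\<And>k. 0 < \<mu> k" "\<mu> \<longlonglongrightarrow> 0"
    and \<epsilon>: "\<And>k. 0 \<le> \<epsilon> k" "\<epsilon> \<longlonglongrightarrow> 0"
    and yh: "(\<lambda>k. \<mu> k * norm (yh k)) \<longlonglongrightarrow> 0"
  shows "u \<longlonglongrightarrow> 0"
proof -
  obtain v0 where v0: "V 0 = ereal v0" using proper_edom_real[OF V(1) V0] .
  obtain C where C: "C \<ge> 0" "\<And>w. ereal (- C * (1 + norm w)) \<le> V w"
    using econvex_lsc_linear_growth[OF V] by auto
  define a where "a k = 2 * (\<mu> k * C + \<mu> k * norm (yh k))" for k
  define b where "b k = 2 * \<mu> k * (\<bar>v0\<bar> + C + \<epsilon> k)" for k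
  have "norm (u k) \<le> a k + sqrt (b k)" for k
  proof (rule le_quadratic_bound)
    have "ereal (- C * (1 + norm (u k))) \<le> ereal (F k)"
      using C(2) VF by (rule order_trans)
    then have "- C * (1 + norm (u k)) \<le> F k" by simp
    moreover have "F k + yh k \<bullet> u k + (norm (u k))\<^sup>2 / (2 * \<mu> k) - \<epsilon> k \<le> v0"
      using bound[of k 0] v0 by simp
    moreover have "- (norm (yh k) * norm (u k)) \<le> yh k \<bullet> u k"
      using Cauchy_Schwarz_ineq2[of "yh k" "u k"] by linarith
    ultimately have "(norm (u k))\<^sup>2 / (2 * \<mu> k)
        \<le> (C + norm (yh k)) * norm (u k) + (\<bar>v0\<bar> + C + \<epsilon> k)"
      by (simp add: algebra_simps)
    then have "(norm (u k))\<^sup>2 \<le> ((C + norm (yh k)) * norm (u k) + (\<bar>v0\<bar> + C + \<epsilon> k)) * (2 * \<mu> k)"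
      using \<mu>(1)[of k] by (simp add: pos_divide_le_eq)
    then show "(norm (u k))\<^sup>2 \<le> a k * norm (u k) + b k"
      by (simp add: a_def b_def algebra_simps)
  qed (use C(1) \<mu>(1)[of k] \<epsilon>(1)[of k] in \<open>auto simp: a_def b_def\<close>)
  moreover have "(\<lambda>k. a k + sqrt (b k)) \<longlonglongrightarrow> 2 * (0 * C + 0) + sqrt (2 * 0 * (\<bar>v0\<bar> + C + 0))"
    unfolding a_def b_def by (intro tendsto_intros \<mu> \<epsilon> yh)
  ultimately show ?thesis
    by (intro Lim_null_comparison[of u]) auto
qed

text \<open>Failure of divergence leaves infinitely many terms in one ball; Bolzano-Weierstrass
  applies along those indices.\<close>

lemma not_at_top_imp_convergent_subseq:
  fixes q :: "nat \<Rightarrow> 'a::euclidean_space"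
  assumes "\<not> filterlim (\<lambda>k. norm (q k)) at_top sequentially"
  obtains r l where "strict_mono r" and "(q \<circ> r) \<longlonglongrightarrow> l"
proof -
  obtain B where "\<not> eventually (\<lambda>k. B \<le> norm (q k)) sequentially"
    using assms unfolding filterlim_at_top by blast
  then have "infinite {k. norm (q k) < B}"
    unfolding eventually_sequentially infinite_nat_iff_unbounded_le by (auto simp: not_le)
  then obtain r0 :: "nat \<Rightarrow> nat" where r0: "strict_mono r0" "\<And>n. norm (q (r0 n)) < B"
    using infinite_enumerate[of "{k. norm (q k) < B}"] by auto
  have "bounded (range (q \<circ> r0))"
    unfolding bounded_iff using r0(2) by (auto intro!: exI[of _ B] less_imp_le)
  then obtain l r1 where "strict_mono r1" "((q \<circ> r0) \<circ> r1) \<longlonglongrightarrow> l"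
    using bounded_imp_convergent_subsequence by blast
  then show ?thesis using that[of "r0 \<circ> r1" l] r0(1) by (simp add: strict_mono_o o_assoc)
qed

text \<open>\<open>n k\<close> counts the failed tests before step \<open>k\<close>. The parameters
  depend on \<open>k\<close> only through \<open>n k\<close>, so their limits reduce to those of
  geometric sequences.\<close>

lemma rejection_counter:
  fixes \<mu> \<rho> :: "nat \<Rightarrow> real" and A :: "nat \<Rightarrow> bool"
  assumes "\<And>k. if A k then \<mu> (Suc k) = \<mu> k \<and> \<rho> (Suc k) = \<rho> k
              else \<mu> (Suc k) = b * \<mu> k \<and> \<rho> (Suc k) = d * \<rho> k"
    and "infinite {k. \<not> A k}"
  obtains n where "filterlim n at_top sequentially"
    and "\<And>k. \<mu> k = b ^ n k * \<mu> 0" and "\<And>k. \<rho> k = d ^ n k * \<rho> 0"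
proof -
  define n where "n = rec_nat 0 (\<lambda>k m. if A k then m else Suc m)"
  have n: "n 0 = 0" "\<And>k. n (Suc k) = (if A k then n k else Suc (n k))"
    by (simp_all add: n_def)
  have "mono n" by (rule incseq_SucI) (simp add: n)
  have unb: "\<exists>k. m \<le> n k" for m
  proof (induction m)
    case (Suc m)
    then obtain k where "m \<le> n k" by blast
    moreover obtain j where "k \<le> j" "\<not> A j"
      using assms(2) unfolding infinite_nat_iff_unbounded_le by blast
    ultimately have "Suc m \<le> n (Suc j)" using monoD[OF \<open>mono n\<close>] n by fastforce
    then show ?case by blast
  qed simp
  have "filterlim n at_top sequentially"
    unfolding filterlim_at_top eventually_sequentially
    using unb monoD[OF \<open>mono n\<close>] by (meson order_trans)
  moreover have "\<mu> k = b ^ n k * \<mu> 0 \<and> \<rho> k = d ^ n k * \<rho> 0" for k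
    using assms(1) by (induction k) (force simp: n)+
  ultimately show ?thesis using that by blast
qed

theorem theorem6p3:
  fixes f :: "real^'n \<Rightarrow> real"
    and g :: "real^'m \<Rightarrow> ereal"
    and c :: "real^'n \<Rightarrow> real^'m"
    and S :: "(real^'m) set"
    and \<theta> \<eta> \<beta> :: real
    and \<epsilon> \<mu> \<rho> :: "nat \<Rightarrow> real"
    and x :: "nat \<Rightarrow> real^'n"
    and z y yh :: "nat \<Rightarrow> real^'m"
  assumes "standing_assumption f g c"
    and "\<forall>xb. minimizer f g c xb \<longrightarrow> \<not> stationary f g c xb"
    and "proper (value_function f g c)"
    and "lsc (value_function f g c)"
    and "elastic_alm f g c S \<theta> \<eta> \<beta> \<epsilon> \<mu> \<rho> x z y yh"
    and "summable (\<lambda>k. sqrt (\<epsilon> k / \<mu> k))"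
  shows "filterlim (\<lambda>k. norm (y k)) at_top sequentially
    \<and> limsup (\<lambda>k. ereal (f (x k)) + g (z k)) \<le> optimal_value f g c
    \<and> (\<forall>xb. (\<exists>r. strict_mono r \<and> (x \<circ> r) \<longlonglongrightarrow> xb) \<longrightarrow> minimizer f g c xb)
    \<and> (\<forall>r xb. strict_mono r \<and> (x \<circ> r) \<longlonglongrightarrow> xb \<longrightarrow>
         (z \<circ> r) \<longlonglongrightarrow> c xb
         \<and> (\<lambda>j. ereal (f (x (r j))) + g (z (r j))) \<longlonglongrightarrow> optimal_value f g c)"
proof -

  \<comment> \<open>Bounds on the parameters and the safeguarded multipliers\<close>
  note sa = assms(1)[unfolded standing_assumption_def]
  note alm = assms(5)[unfolded elastic_alm_def Let_def]
  have g: "proper g" "lsc g" "econvex g" using sa by auto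
  define V where "V = value_function f g c"
  define u where "u k = c (x k) - z k" for k
  define A where "A k \<longleftrightarrow> k = 0 \<or> norm (u k) \<le> \<theta> * norm (u (k - 1))" for k
  have \<theta>: "0 < \<theta>" "\<theta> < 1" and \<eta>: "0 < \<eta>" "\<eta> < 1" and \<beta>: "\<eta>\<^sup>2 < \<beta>" "\<beta> < \<eta>"
    and \<mu>0: "0 < \<mu> 0" and \<rho>0: "\<rho> 0 = 1" and S: "S \<noteq> {}" "compact S"
    using alm by auto
  have \<beta>0: "0 < \<beta>" "\<beta> < 1"
    using \<beta> \<eta> zero_le_power2[of \<eta>] by linarith+
  have yh: "yh k = closest_point ((\<lambda>s. \<rho> k *\<^sub>R s) ` S) (y k)"
    and \<epsilon>0: "0 \<le> \<epsilon> k"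
    and opt: "aug_lagrangian f g c (\<mu> k) (x k) (yh k)
         \<le> (INF x'. aug_lagrangian f g c (\<mu> k) x' (yh k)) + ereal (\<epsilon> k)"
    and z: "z k = prox (\<lambda>w. ereal (\<mu> k) * g w) (c (x k) + \<mu> k *\<^sub>R yh k)"
    and y: "y (Suc k) = yh k + (1 / \<mu> k) *\<^sub>R u k"
    and upd: "if A k then \<mu> (Suc k) = \<mu> k \<and> \<rho> (Suc k) = \<rho> k
         else \<mu> (Suc k) = \<beta> * \<mu> k \<and> \<rho> (Suc k) = (\<eta> / \<beta>) * \<rho> k" for k
    using alm unfolding A_def u_def by blast+
  have pos: "0 < \<mu> k \<and> \<mu> k \<le> \<mu> 0 \<and> 0 < \<rho> k" for k
  proof (induction k)
    case (Suc k)
    have "\<beta> * \<mu> k \<le> 1 * \<mu> k" using Suc \<beta>0 by (intro mult_right_mono) auto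
    then have "\<beta> * \<mu> k \<le> \<mu> 0" using Suc by linarith
    then show ?case using Suc upd[of k] \<beta>0 \<eta> by (auto split: if_splits)
  qed (simp add: \<mu>0 \<rho>0)
  then have \<mu>: "0 < \<mu> k" "\<mu> k \<le> \<mu> 0" and \<rho>: "0 < \<rho> k" for k by auto
  obtain B where B: "\<And>s. s \<in> S \<Longrightarrow> norm s \<le> B"
    using compact_imp_bounded[OF S(2)] unfolding bounded_iff by blast
  \<comment> \<open>The projection lies in the scaled compact set, so the safeguarded multiplier
    grows at most like \<open>\<rho> k\<close>.\<close>
  have normyh: "norm (yh k) \<le> \<rho> k * B" for k
  proof -
    have "yh k \<in> (\<lambda>s. \<rho> k *\<^sub>R s) ` S"
      unfolding yh using S by (intro closest_point_in_set compact_imp_closed compact_scaling) auto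
    then show ?thesis using B \<rho>[of k] by auto
  qed

  \<comment> \<open>The value function at zero\<close>
  obtain xs where xs: "minimizer f g c xs" using sa by blast
  have V0: "V 0 = optimal_value f g c"
    by (simp add: V_def value_function_def optimal_value_def objective_def)
  have V0xs: "V 0 = objective f g c xs"
    unfolding V0 optimal_value_def using xs
    by (intro antisym INF_lower2[of xs] INF_greatest) (auto simp: minimizer_def)
  have "c xs \<in> edom g" using xs by (simp add: minimizer_def feasible_def)
  then obtain gs where gs: "g (c xs) = ereal gs" by (rule proper_edom_real[OF g(1)])
  define v0 where "v0 = f xs + gs"
  have v0: "V 0 = ereal v0" by (simp add: V0xs objective_def gs v0_def)
  then have V0dom: "0 \<in> edom V" by (simp add: edom_def)
  have V: "proper V" "lsc V" using assms(3,4) by (simp_all add: V_def)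
  have Vconv: "econvex V"
    using value_function_econvex[of f g c] sa assms(3) by (auto simp: V_def)
  have nosub: "- q \<notin> subdifferential V 0" for q
    using value_subgradient_imp_stationary[of f c g xs q] xs assms(2) sa by (auto simp: V_def)

  \<comment> \<open>Approximate optimality of the iterates\<close>
  have "\<exists>b. g (z k) = ereal b" for k
    using prox_mult_minimizes(2)[OF g \<mu>(1), of k] proper_edom_real[OF g(1)] unfolding z by metis
  then obtain G where G: "\<And>k. g (z k) = ereal (G k)" by metis
  define F where "F k = f (x k) + G k" for k
  have bound: "ereal (F k + yh k \<bullet> u k + (norm (u k))\<^sup>2 / (2 * \<mu> k)
                  - yh k \<bullet> v - (norm v)\<^sup>2 / (2 * \<mu> k) - \<epsilon> k) \<le> V v" for k v
    unfolding F_def u_def V_def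
    by (rule aug_lagrangian_value_bound[OF g \<mu>(1) z G opt])
  have VF: "V (u k) \<le> ereal (F k)" for k
    unfolding V_def value_function_def by (rule INF_lower2[of "x k"]) (auto simp: u_def F_def G)
  \<comment> \<open>The terms of a convergent series vanish; squaring yields the rate
    \<open>\<epsilon> k / \<mu> k\<close> that the limit of subgradients asks for.\<close>
  have "(\<lambda>k. (sqrt (\<epsilon> k / \<mu> k))\<^sup>2) \<longlonglongrightarrow> 0\<^sup>2"
    by (intro tendsto_intros summable_LIMSEQ_zero assms(6))
  then have \<epsilon>\<mu>: "(\<lambda>k. \<epsilon> k / \<mu> k) \<longlonglongrightarrow> 0"
    using \<epsilon>0 \<mu>(1) by (simp add: less_imp_le)
  \<comment> \<open>The multiplier formed from \<open>u k\<close> is stored at index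
    \<open>Suc k\<close>, hence the shift. The uniform bound on the penalty parameters is
    \<open>\<mu> 0\<close>.\<close>
  have contra: False if r: "strict_mono r" "(\<lambda>k. u (r k)) \<longlonglongrightarrow> 0"
      "(\<lambda>k. y (Suc (r k))) \<longlonglongrightarrow> q" for r q
  proof -
    have "- q \<in> subdifferential V 0"
    proof (rule subdifferential_limit[OF V Vconv V0dom, of "F \<circ> r" "yh \<circ> r" "u \<circ> r" "\<mu> \<circ> r" "\<epsilon> \<circ> r"])
      show "(\<lambda>k. (\<epsilon> \<circ> r) k / (\<mu> \<circ> r) k) \<longlonglongrightarrow> 0"
        using LIMSEQ_subseq_LIMSEQ[OF \<epsilon>\<mu> r(1)] by (simp add: o_def)
    qed (use bound VF \<mu> r(2,3) in \<open>auto simp: o_def y\<close>)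
    then show False using nosub by blast
  qed

  \<comment> \<open>Infinitely many penalty updates\<close>
  have inf: "infinite {k. \<not> A k}"
  proof
    assume "finite {k. \<not> A k}"
    then obtain N where N: "\<And>k. N \<le> k \<Longrightarrow> A k"
      unfolding finite_nat_set_iff_bounded by (meson mem_Collect_eq not_le)
    have const: "\<mu> (N + j) = \<mu> N \<and> \<rho> (N + j) = \<rho> N" for j
    proof (induction j)
      case (Suc j)
      then show ?case using upd[of "N + j"] N[of "N + j"] by simp
    qed simp
    have geo: "norm (u (N + j)) \<le> \<theta> ^ j * norm (u N)" for j
    proof (induction j)
      case (Suc j)
      have "norm (u (N + Suc j)) \<le> \<theta> * norm (u (N + j))"
        using N[of "N + Suc j"] by (simp add: A_def)
      also have "\<dots> \<le> \<theta> * (\<theta> ^ j * norm (u N))"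
        using Suc \<theta> by (intro mult_left_mono) auto
      finally show ?case by simp
    qed simp
    have "(\<lambda>j. \<theta> ^ j * norm (u N)) \<longlonglongrightarrow> 0 * norm (u N)"
      using \<theta> by (intro tendsto_intros LIMSEQ_power_zero) auto
    then have lim: "(\<lambda>j. u (N + j)) \<longlonglongrightarrow> 0"
      using geo by (intro Lim_null_comparison[of "\<lambda>j. u (N + j)"]) auto
    \<comment> \<open>With \<open>\<mu>\<close> and \<open>\<rho>\<close> frozen from
      \<open>N\<close> on, the safeguarded multipliers stay in a fixed ball, and the decaying
      residuals bound the correction.\<close>
    have "norm (y (Suc (N + j))) \<le> \<rho> N * B + (1 / \<mu> N) * norm (u N)" for j
    proof -
      have "norm (u (N + j)) \<le> norm (u N)"
        using geo[of j] \<theta> by (meson less_imp_le mult_left_le_one_le norm_ge_zero order_trans power_le_one zero_le_power)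
      then have "(1 / \<mu> N) * norm (u (N + j)) \<le> (1 / \<mu> N) * norm (u N)"
        using \<mu>(1)[of N] by (intro mult_left_mono) auto
      moreover have "norm (y (Suc (N + j))) \<le> norm (yh (N + j)) + (1 / \<mu> N) * norm (u (N + j))"
        unfolding y using \<mu>(1)[of N] const[of j]
        by (intro order_trans[OF norm_triangle_ineq]) simp
      ultimately show ?thesis using normyh[of "N + j"] const[of j] by simp
    qed
    then have "bounded (range (\<lambda>j. y (Suc (N + j))))" unfolding bounded_iff by blast
    then obtain q r where "strict_mono r" "((\<lambda>j. y (Suc (N + j))) \<circ> r) \<longlonglongrightarrow> q"
      using bounded_imp_convergent_subsequence by blast
    then show False
      using contra[of "\<lambda>j. N + r j" q] LIMSEQ_subseq_LIMSEQ[OF lim, of r]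
      by (simp add: o_def strict_mono_def)
  qed

  \<comment> \<open>Decay rates of penalty and multiplier terms\<close>
  obtain n where n: "filterlim n at_top sequentially"
    and \<mu>n: "\<And>k. \<mu> k = \<beta> ^ n k * \<mu> 0" and \<rho>n: "\<And>k. \<rho> k = (\<eta> / \<beta>) ^ n k * \<rho> 0"
    using rejection_counter[OF upd inf] by blast
  have pow: "(\<lambda>k. a ^ n k * d) \<longlonglongrightarrow> 0" if "0 \<le> a" "a < 1" for a d :: real
  proof -
    have "(\<lambda>k. a ^ n k * d) \<longlonglongrightarrow> 0 * d"
      by (intro tendsto_intros filterlim_compose[OF LIMSEQ_power_zero n]) (use that in auto)
    then show ?thesis by simp
  qed
  have "(\<lambda>k. \<beta> ^ n k * \<mu> 0) = \<mu>" by (rule ext) (rule \<mu>n[symmetric])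
  then have \<mu>lim: "\<mu> \<longlonglongrightarrow> 0" using pow[of \<beta> "\<mu> 0"] \<beta>0 by (metis less_imp_le)
  have "(\<lambda>k. \<mu> k * (\<epsilon> k / \<mu> k)) \<longlonglongrightarrow> 0 * 0" by (intro tendsto_mult \<mu>lim \<epsilon>\<mu>)
  then have \<epsilon>lim: "\<epsilon> \<longlonglongrightarrow> 0" using \<mu>(1) by (simp add: less_imp_neq[symmetric])
  \<comment> \<open>Each rejection multiplies \<open>\<mu> k * \<rho> k\<close> by
    \<open>\<beta> * (\<eta> / \<beta>) = \<eta>\<close>.\<close>
  have "norm (\<mu> k * norm (yh k)) \<le> \<eta> ^ n k * (\<mu> 0 * B)" for k
  proof -
    have "\<mu> k * norm (yh k) \<le> \<mu> k * (\<rho> k * B)"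
      using normyh \<mu>(1)[of k] by (intro mult_left_mono) auto
    also have "\<mu> k * (\<rho> k * B) = \<eta> ^ n k * (\<mu> 0 * B)"
      unfolding \<mu>n[of k] \<rho>n[of k] \<rho>0 using \<beta>0 by (simp add: power_divide)
    finally show ?thesis using \<mu>(1)[of k] by simp
  qed
  then have yhlim: "(\<lambda>k. \<mu> k * norm (yh k)) \<longlonglongrightarrow> 0"
    by (rule Lim_null_comparison[OF always_eventually[OF allI]]) (use pow \<eta> in auto)
  \<comment> \<open>Each rejection multiplies \<open>\<mu> k * (\<rho> k)\<^sup>2\<close> by
    \<open>\<eta>\<^sup>2 / \<beta>\<close>, which is below 1 by the lower bound on
    \<open>\<beta>\<close>.\<close>
  have "norm (\<mu> k * (norm (yh k))\<^sup>2) \<le> (\<eta>\<^sup>2 / \<beta>) ^ n k * (\<mu> 0 * B\<^sup>2)" for k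
  proof -
    have "\<mu> k * (norm (yh k))\<^sup>2 \<le> \<mu> k * (\<rho> k * B)\<^sup>2"
      using normyh \<mu>(1)[of k] by (intro mult_left_mono power_mono) auto
    also have "\<mu> k * (\<rho> k * B)\<^sup>2 = (\<beta> * (\<eta> / \<beta>)\<^sup>2) ^ n k * (\<mu> 0 * B\<^sup>2)"
      unfolding \<mu>n[of k] \<rho>n[of k] \<rho>0
      by (simp only: power_mult_distrib mult_1_right power2_eq_square) (simp add: mult_ac)
    also have "\<beta> * (\<eta> / \<beta>)\<^sup>2 = \<eta>\<^sup>2 / \<beta>" using \<beta>0 by (simp add: power2_eq_square)
    finally show ?thesis using \<mu>(1)[of k] by simp
  qed
  then have yh2lim: "(\<lambda>k. \<mu> k * (norm (yh k))\<^sup>2) \<longlonglongrightarrow> 0"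
    by (rule Lim_null_comparison[OF always_eventually[OF allI]]) (use pow \<beta> \<beta>0 in auto)

  \<comment> \<open>Vanishing residuals and divergence of the multipliers\<close>
  have ulim: "u \<longlonglongrightarrow> 0"
    by (rule proximal_residual_tendsto_0[OF V Vconv V0dom bound VF \<mu>(1) \<mu>lim \<epsilon>0 \<epsilon>lim yhlim])

  have ylim: "filterlim (\<lambda>k. norm (y k)) at_top sequentially"
  proof (rule ccontr)
    assume "\<not> filterlim (\<lambda>k. norm (y k)) at_top sequentially"
    then have "\<not> filterlim (\<lambda>k. norm (y (Suc k))) at_top sequentially"
      using filterlim_sequentially_Suc[of "\<lambda>k. norm (y k)"] by blast
    then obtain r q where "strict_mono r" "((\<lambda>k. y (Suc k)) \<circ> r) \<longlonglongrightarrow> q"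
      using not_at_top_imp_convergent_subseq[of "\<lambda>k. y (Suc k)"] by blast
    then show False
      using contra[of r q] LIMSEQ_subseq_LIMSEQ[OF ulim, of r] by (simp add: o_def)
  qed

  \<comment> \<open>Upper bound on the objective values\<close>
  have FG: "ereal (f (x k)) + g (z k) = ereal (F k)" for k by (simp add: F_def G)
  \<comment> \<open>Comparison with \<open>v = 0\<close>. Completing the square in
    \<open>u k\<close> and dropping \<open>(norm (u k + \<mu> k *\<^sub>R yh k))\<^sup>2 / (2 *
    \<mu> k)\<close> leaves only the last term as multiplier error.\<close>
  have "F k \<le> v0 + \<epsilon> k + \<mu> k * (norm (yh k))\<^sup>2 / 2" for k
  proof -
    have "F k + yh k \<bullet> u k + (norm (u k))\<^sup>2 / (2 * \<mu> k) - \<epsilon> k \<le> v0"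
      using bound[of k 0] v0 by simp
    moreover have "0 \<le> (norm (u k + \<mu> k *\<^sub>R yh k))\<^sup>2 / (2 * \<mu> k)" using \<mu>(1)[of k] by simp
    moreover have "(norm (u k + \<mu> k *\<^sub>R yh k))\<^sup>2 / (2 * \<mu> k)
        = yh k \<bullet> u k + (norm (u k))\<^sup>2 / (2 * \<mu> k) + \<mu> k * (norm (yh k))\<^sup>2 / 2"
      using \<mu>(1)[of k] unfolding power2_norm_eq_inner
      by (simp add: field_simps inner_simps inner_commute power2_eq_square)
    ultimately show ?thesis by linarith
  qed
  then have "limsup (\<lambda>k. ereal (F k)) \<le> limsup (\<lambda>k. ereal (v0 + \<epsilon> k + \<mu> k * (norm (yh k))\<^sup>2 / 2))"
    by (intro Limsup_mono) auto
  also have "(\<lambda>k. ereal (v0 + \<epsilon> k + \<mu> k * (norm (yh k))\<^sup>2 / 2)) \<longlonglongrightarrow> ereal (v0 + 0 + 0 / 2)"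
    by (intro tendsto_intros \<epsilon>lim yh2lim) auto
  then have "limsup (\<lambda>k. ereal (v0 + \<epsilon> k + \<mu> k * (norm (yh k))\<^sup>2 / 2)) = ereal v0"
    by (intro lim_imp_Limsup) auto
  finally have limsup: "limsup (\<lambda>k. ereal (F k)) \<le> ereal v0" .

  \<comment> \<open>Convergence along subsequences\<close>
  have f_cont: "isCont f w" and c_cont: "isCont c w" for w
    using sa by (meson continuously_differentiable_imp_has_derivative has_derivative_continuous)+
  have sub: "minimizer f g c xb \<and> (z \<circ> r) \<longlonglongrightarrow> c xb \<and> (\<lambda>j. ereal (F (r j))) \<longlonglongrightarrow> ereal v0"
    if r: "strict_mono r" "(x \<circ> r) \<longlonglongrightarrow> xb" for r xb
  proof -
    have "(\<lambda>j. c (x (r j)) - u (r j)) \<longlonglongrightarrow> c xb - 0"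
      using isCont_tendsto_compose[OF c_cont r(2)] LIMSEQ_subseq_LIMSEQ[OF ulim r(1)]
      by (intro tendsto_diff) (simp_all add: o_def)
    then have zlim: "(\<lambda>j. z (r j)) \<longlonglongrightarrow> c xb" by (simp add: u_def)
    have "(\<lambda>j. ereal (f (x (r j)))) \<longlonglongrightarrow> ereal (f xb)"
      using isCont_tendsto_compose[OF f_cont r(2)] by (simp add: o_def)
    \<comment> \<open>The liminf of the sum splits because the \<open>f\<close> part has a finite
      limit.\<close>
    then have "liminf (\<lambda>j. ereal (f (x (r j))) + g (z (r j))) = ereal (f xb) + liminf (\<lambda>j. g (z (r j)))"
      by (intro ereal_liminf_lim_add) auto
    \<comment> \<open>Facts 1 to 4 form a cycle: objective at \<open>xb\<close>, liminf, limsup,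
      \<open>v0\<close>, objective at \<open>xb\<close>. The first three give feasibility and, with
      the fourth, minimality; equality throughout gives the limit.\<close>
    then have 1: "objective f g c xb \<le> liminf (\<lambda>j. ereal (F (r j)))"
      unfolding FG objective_def using lsc_liminf[OF g(2) zlim] by (simp add: add_left_mono)
    have 2: "liminf (\<lambda>j. ereal (F (r j))) \<le> limsup (\<lambda>j. ereal (F (r j)))"
      by (simp add: Liminf_le_Limsup)
    have 3: "limsup (\<lambda>j. ereal (F (r j))) \<le> ereal v0"
      using limsup_subseq_mono[OF r(1), of "\<lambda>k. ereal (F k)"] limsup by (simp add: o_def)
    have 4: "ereal v0 \<le> objective f g c w" for w
      unfolding v0[symmetric] V0 optimal_value_def by (rule INF_lower) simp
    have le: "objective f g c xb \<le> ereal v0" using 1 2 3 by simp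
    then have "g (c xb) < \<infinity>" unfolding objective_def by (cases "g (c xb)") auto
    then have "minimizer f g c xb"
      unfolding minimizer_def feasible_def edom_def using le 4 by (auto intro: order_trans)
    moreover have "(\<lambda>j. ereal (F (r j))) \<longlonglongrightarrow> ereal v0"
      using 1 2 3 4[of xb] by (intro iffD2[OF tendsto_iff_Liminf_eq_Limsup]) auto
    ultimately show ?thesis using zlim by (simp add: o_def)
  qed
  show ?thesis
    unfolding FG V0[symmetric] v0 using ylim limsup sub by blast
qed

end
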